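(* Let $n \ge 2$ and $N \ge 1$ be integers. For $f,g \in \mathcal{E}$ (defined below) one has $E f \ge 0$ and $E(fg) \ge (E f)(E g)$, where $$E f = \int f(\sigma_1,\dots,\sigma_N)\, d\sigma_1 \cdots d\sigma_N$$ and each $d\sigma_i$ is normalized Lebesgue (uniform probability) measure on the unit sphere $\mathbb{S}^{n-1}\subset\mathbb{R}^n$.
   Context: Variables $\sigma_1,\dots,\sigma_N$ range over $\mathbb{S}^{n-1}$, and $\sigma_i\cdot\sigma_j$ denotes the Euclidean inner product in $\mathbb{R}^n$. $\mathcal{E}$ is the set of (finite) linear combinations with positive coefficients of monomials of the form $\prod_{1\le i<j\le N} (\sigma_i\cdot\sigma_j)^{n_{i,j}}$, where the $n_{i,j}\ge 0$ are integers. *)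

theory Defs
  imports "HOL-Analysis.Analysis"
begin

text \<open>Normalized (probability) surface measure on the unit sphere of \<open>real^'n\<close>,
  realised as the cone measure: the image of the uniform probability measure on the
  unit ball under radial projection \<open>x \<mapsto> x / norm x\<close> (i.e. \<open>sgn\<close>).  For a Borel set
  \<open>A\<close> of the sphere this gives \<open>vol{t x | x\<in>A, 0<t\<le>1} / vol(ball 0 1)\<close>, which is
  the normalized Lebesgue (surface) measure of \<open>A\<close>.\<close>
definition sphere_measure :: "(real^'n) measure" where
  "sphere_measure = distr (uniform_measure lborel (ball 0 1)) borel sgn"

definition sphere_prod :: "nat \<Rightarrow> (nat \<Rightarrow> real^'n) measure" where
  "sphere_prod N = PiM {..<N} (\<lambda>_. sphere_measure)"

definition Exp :: "nat \<Rightarrow> ((nat \<Rightarrow> real^'n) \<Rightarrow> real) \<Rightarrow> real" where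
  "Exp N f = integral\<^sup>L (sphere_prod N) f"

definition monomial :: "nat \<Rightarrow> (nat \<Rightarrow> nat \<Rightarrow> nat) \<Rightarrow> (nat \<Rightarrow> real^'n) \<Rightarrow> real" where
  "monomial N e \<sigma> = (\<Prod>i<N. \<Prod>j\<in>{i<..<N}. (\<sigma> i \<bullet> \<sigma> j) ^ (e i j))"

definition posmono :: "nat \<Rightarrow> ((nat \<Rightarrow> real^'n) \<Rightarrow> real) set" where
  "posmono N = {f. \<exists>(K::nat set) (c::nat \<Rightarrow> real) (e::nat \<Rightarrow> nat \<Rightarrow> nat \<Rightarrow> nat).
      finite K \<and> K \<noteq> {} \<and> (\<forall>k\<in>K. c k > 0) \<and>
      f = (\<lambda>\<sigma>. \<Sum>k\<in>K. c k * monomial N (e k) \<sigma>)}"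

end

theory Submission
  imports Defs "HOL-Probability.Infinite_Product_Measure"
begin

text \<open>Call Gram polynomials (\<open>gram_cone\<close>) the polynomials in the inner products
  \<open>\<sigma> i \<bullet> \<sigma> j\<close> with nonnegative coefficients. Integrating out one variable maps Gram polynomials
  to Gram polynomials: by rotation invariance the integral of \<open>(x \<bullet> w) ^ m\<close> is a nonnegative
  multiple of \<open>norm w ^ m\<close> and vanishes for odd \<open>m\<close>, and differentiating repeatedly in the
  direction of other vectors, which preserves Gram polynomials, turns this into the integral of an
  arbitrary product of factors \<open>x \<bullet> v\<close>. Hence integrals of Gram polynomials are nonnegative.
  Moreover, identifying two variables increases the integral: once all the others are integrated
  out, what remains is a polynomial in \<open>\<sigma> i \<bullet> \<sigma> j\<close> with nonnegative coefficients, whose mean is at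
  most its value at 1. Finally \<open>E f * E g\<close> is the integral of \<open>f \<sigma> * g \<tau>\<close> over two independent
  copies of the variables, and identifying \<open>\<tau> i\<close> with \<open>\<sigma> i\<close> for one \<open>i\<close> after the other leads to
  \<open>E (f g)\<close>.\<close>

section \<open>Gram polynomials with nonnegative coefficients\<close>

inductive_set gram_cone :: "'i set \<Rightarrow> (('i \<Rightarrow> 'v::real_inner) \<Rightarrow> real) set" for I where
  const: "c \<ge> 0 \<Longrightarrow> (\<lambda>_. c) \<in> gram_cone I"
| add: "f \<in> gram_cone I \<Longrightarrow> g \<in> gram_cone I \<Longrightarrow> (\<lambda>\<sigma>. f \<sigma> + g \<sigma>) \<in> gram_cone I"
| inner: "i \<in> I \<Longrightarrow> j \<in> I \<Longrightarrow> f \<in> gram_cone I \<Longrightarrow> (\<lambda>\<sigma>. (\<sigma> i \<bullet> \<sigma> j) * f \<sigma>) \<in> gram_cone I"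

lemma gram_cone_scale:
  assumes "c \<ge> 0" "f \<in> gram_cone I"
  shows "(\<lambda>\<sigma>. c * f \<sigma>) \<in> gram_cone I"
  using assms(2)
proof induction
  case (const d)
  then show ?case using assms(1) by (intro gram_cone.const) simp
next
  case (add f g)
  then show ?case by (simp add: distrib_left gram_cone.add)
next
  case (inner i j f)
  then show ?case
    using gram_cone.inner[of i I j "\<lambda>\<sigma>. c * f \<sigma>"] by (simp add: mult.left_commute)
qed

lemma gram_cone_mult:
  assumes "f \<in> gram_cone I" "g \<in> gram_cone I"
  shows "(\<lambda>\<sigma>. f \<sigma> * g \<sigma>) \<in> gram_cone I"
  using assms(1)
proof induction
  case (const c)
  then show ?case using assms(2) by (rule gram_cone_scale)
next
  case (add f h)
  then show ?case by (simp add: distrib_right gram_cone.add)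
next
  case (inner i j f)
  then show ?case
    using gram_cone.inner[of i I j "\<lambda>\<sigma>. f \<sigma> * g \<sigma>"] by (simp add: mult.assoc)
qed

lemma gram_cone_sum:
  assumes "\<And>k. k \<in> K \<Longrightarrow> f k \<in> gram_cone I"
  shows "(\<lambda>\<sigma>. \<Sum>k\<in>K. f k \<sigma>) \<in> gram_cone I"
  using assms
  by (induction K rule: infinite_finite_induct) (auto intro: gram_cone.add gram_cone.const)

lemma gram_cone_prod:
  assumes "\<And>k. k \<in> K \<Longrightarrow> f k \<in> gram_cone I"
  shows "(\<lambda>\<sigma>. \<Prod>k\<in>K. f k \<sigma>) \<in> gram_cone I"
  using assms
  by (induction K rule: infinite_finite_induct) (auto intro: gram_cone_mult gram_cone.const)

lemma gram_cone_power:
  assumes "f \<in> gram_cone I"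
  shows "(\<lambda>\<sigma>. f \<sigma> ^ k) \<in> gram_cone I"
  using gram_cone_prod[of "{..<k}" "\<lambda>_. f"] assms by simp

lemma gram_cone_inner:
  assumes "i \<in> I" "j \<in> I"
  shows "(\<lambda>\<sigma>. \<sigma> i \<bullet> \<sigma> j) \<in> gram_cone I"
  using gram_cone.inner[OF assms gram_cone.const[of 1]] by simp

lemma gram_cone_reindex:
  assumes "f \<in> gram_cone I" "r ` I \<subseteq> J"
  shows "(\<lambda>\<sigma>. f (\<lambda>i. \<sigma> (r i))) \<in> gram_cone J"
  using assms(1) by induction (use assms(2) in \<open>auto intro!: gram_cone.intros\<close>)

lemma gram_cone_mono:
  assumes "f \<in> gram_cone I" "I \<subseteq> J"
  shows "f \<in> gram_cone J"
  using gram_cone_reindex[of f I id J] assms by simp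

lemma gram_cone_merge:
  assumes "f \<in> gram_cone (insert i I)" "j \<in> I"
  shows "(\<lambda>\<sigma>. f (\<sigma>(i := \<sigma> j))) \<in> gram_cone I"
proof -
  have "(\<lambda>\<sigma>. f (\<sigma>(i := \<sigma> j))) = (\<lambda>\<sigma>. f (\<lambda>k. \<sigma> (if k = i then j else k)))"
    by (intro ext arg_cong[where f=f]) auto
  also have "\<dots> \<in> gram_cone I"
    by (rule gram_cone_reindex[OF assms(1)]) (use assms(2) in auto)
  finally show ?thesis .
qed

lemma gram_cone_update_zero:
  assumes "f \<in> gram_cone (insert i I)"
  shows "(\<lambda>\<sigma>. f (\<sigma>(i := 0))) \<in> gram_cone I"
  using assms
proof induction
  case (inner j k f)
  show ?case
  proof (cases "j = i \<or> k = i")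
    case True
    then have "(\<lambda>\<sigma>. ((\<sigma>(i := 0)) j \<bullet> (\<sigma>(i := 0)) k) * f (\<sigma>(i := 0))) = (\<lambda>_. 0)"
      by auto
    then show ?thesis by (simp only: gram_cone.const order_refl)
  next
    case False
    with inner.hyps(1,2) show ?thesis
      using gram_cone.inner[OF _ _ inner.IH, of j k] by (simp add: fun_upd_other del: fun_upd_apply)
  qed
qed (auto intro: gram_cone.intros)

lemma DERIV_inner_update:
  "((\<lambda>t. (\<sigma>(i := \<sigma> i + t *\<^sub>R v)) a \<bullet> (\<sigma>(i := \<sigma> i + t *\<^sub>R v)) b) has_real_derivative
    (if a = i then v \<bullet> \<sigma> b else 0) + (if b = i then \<sigma> a \<bullet> v else 0)) (at 0)"
  by (auto simp: inner_add_left inner_add_right inner_commute intro!: derivative_eq_intros)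

lemma gram_cone_directional_derivative:
  assumes "f \<in> gram_cone I" "j \<in> I"
  shows "\<exists>f'\<in>gram_cone I. \<forall>\<sigma>.
    ((\<lambda>t. f (\<sigma>(i := \<sigma> i + t *\<^sub>R \<sigma> j))) has_real_derivative f' \<sigma>) (at 0)"
  using assms(1)
proof induction
  case (const c)
  show ?case by (rule bexI[OF _ gram_cone.const[OF order_refl]]) simp
next
  case (add f g)
  then obtain f' g' where "f' \<in> gram_cone I" "g' \<in> gram_cone I"
    "\<And>\<sigma>. ((\<lambda>t. f (\<sigma>(i := \<sigma> i + t *\<^sub>R \<sigma> j))) has_real_derivative f' \<sigma>) (at 0)"
    "\<And>\<sigma>. ((\<lambda>t. g (\<sigma>(i := \<sigma> i + t *\<^sub>R \<sigma> j))) has_real_derivative g' \<sigma>) (at 0)"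
    by blast
  then show ?case by (intro bexI[OF _ gram_cone.add] allI DERIV_add)
next
  case (inner a b f)
  then obtain f' where f': "f' \<in> gram_cone I"
    "\<And>\<sigma>. ((\<lambda>t. f (\<sigma>(i := \<sigma> i + t *\<^sub>R \<sigma> j))) has_real_derivative f' \<sigma>) (at 0)"
    by blast
  let ?d = "\<lambda>\<sigma>. (if a = i then \<sigma> j \<bullet> \<sigma> b else 0) + (if b = i then \<sigma> a \<bullet> \<sigma> j else 0)"
  have d: "?d \<in> gram_cone I"
    using inner.hyps assms(2)
    by (intro gram_cone.add; cases "a = i"; cases "b = i")
      (simp_all add: gram_cone.const gram_cone_inner)
  have "(\<lambda>\<sigma>. ?d \<sigma> * f \<sigma> + f' \<sigma> * (\<sigma> a \<bullet> \<sigma> b)) \<in> gram_cone I"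
    using inner.hyps
    by (intro gram_cone.add gram_cone_mult[OF d] gram_cone_mult[OF f'(1)] gram_cone_inner)
  moreover have "((\<lambda>t. ((\<sigma>(i := \<sigma> i + t *\<^sub>R \<sigma> j)) a \<bullet> (\<sigma>(i := \<sigma> i + t *\<^sub>R \<sigma> j)) b)
      * f (\<sigma>(i := \<sigma> i + t *\<^sub>R \<sigma> j))) has_real_derivative ?d \<sigma> * f \<sigma> + f' \<sigma> * (\<sigma> a \<bullet> \<sigma> b)) (at 0)"
    for \<sigma>
    using DERIV_mult[OF DERIV_inner_update f'(2), of \<sigma> i "\<sigma> j" a b \<sigma>]
    by (simp del: fun_upd_apply)
  ultimately show ?case by (intro bexI allI)
qed

lemma gram_cone_cong:
  assumes "f \<in> gram_cone I" "\<And>i. i \<in> I \<Longrightarrow> \<sigma> i = \<tau> i"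
  shows "f \<sigma> = f \<tau>"
  using assms(1) by induction (auto simp: assms(2))

lemma continuous_on_gram_cone:
  assumes "f \<in> gram_cone I" "\<And>i. i \<in> I \<Longrightarrow> continuous_on A (\<lambda>x. \<sigma> x i)"
  shows "continuous_on A (\<lambda>x. f (\<sigma> x))"
  using assms(1) by induction (auto intro!: continuous_intros assms(2))

lemma borel_measurable_gram_cone:
  fixes \<sigma> :: "'a \<Rightarrow> 'i \<Rightarrow> 'v::{real_inner, second_countable_topology}"
  assumes "f \<in> gram_cone I" "\<And>i. i \<in> I \<Longrightarrow> (\<lambda>x. \<sigma> x i) \<in> borel_measurable M"
  shows "(\<lambda>x. f (\<sigma> x)) \<in> borel_measurable M"
  using assms(1) by induction (auto intro!: borel_measurable_times borel_measurable_inner assms(2))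

lemma gram_cone_diagonal_nonneg:
  assumes "f \<in> gram_cone I"
  shows "f (\<lambda>_. u) \<ge> 0"
  using assms by induction auto

lemma gram_cone_abs_le_diagonal:
  assumes "f \<in> gram_cone I" "\<And>i. i \<in> I \<Longrightarrow> norm (\<sigma> i) = 1" "norm u = 1"
  shows "\<bar>f \<sigma>\<bar> \<le> f (\<lambda>_. u)"
  using assms(1)
proof induction
  case (inner i j f)
  have "\<bar>\<sigma> i \<bullet> \<sigma> j\<bar> \<le> 1"
    using Cauchy_Schwarz_ineq2[of "\<sigma> i" "\<sigma> j"] assms(2) inner by simp
  then have "\<bar>\<sigma> i \<bullet> \<sigma> j\<bar> * \<bar>f \<sigma>\<bar> \<le> 1 * f (\<lambda>_. u)"
    using inner by (intro mult_mono) auto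
  then show ?case using assms(3) by (simp add: abs_mult norm_eq_1)
qed auto

lemma gram_cone_singleton_eq_diagonal:
  assumes "f \<in> gram_cone {i}" "norm (\<sigma> i) = 1" "norm u = 1"
  shows "f \<sigma> = f (\<lambda>_. u)"
  using assms(1) by induction (use assms(2,3) in \<open>auto simp: norm_eq_1\<close>)

section \<open>Integrating out one variable\<close>

lemma orthogonal_transformation_exists_real_inner:
  fixes v w :: "'a::real_inner"
  assumes "norm v = norm w"
  obtains T where "orthogonal_transformation T" "T v = w"
proof
  define u where "u = v - w"
  define T where "T x = x - (2 * (x \<bullet> u) / (u \<bullet> u)) *\<^sub>R u" for x
    \<comment> \<open>the reflection exchanging \<open>v\<close> and \<open>w\<close>; for \<open>v = w\<close> division by zero makes it the identity\<close>
  have "linear T"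
    by (rule linearI) (simp_all add: T_def algebra_simps inner_add_left add_divide_distrib)
  moreover have "T x \<bullet> T y = x \<bullet> y" for x y
    by (cases "u = 0")
      (simp_all add: T_def inner_diff_left inner_diff_right inner_commute field_simps)
  ultimately show "orthogonal_transformation T"
    by (simp add: orthogonal_transformation_def)
  have "2 * (v \<bullet> u) = u \<bullet> u"
    using assms by (simp add: u_def norm_eq inner_diff_left inner_diff_right inner_commute)
  then show "T v = w"
    by (cases "u = 0") (simp_all add: T_def, simp_all add: u_def)
qed

lemma orthogonal_transformation_borel_measurable:
  fixes T :: "'a::euclidean_space \<Rightarrow> 'a"
  assumes "orthogonal_transformation T"
  shows "T \<in> borel_measurable borel"
  using orthogonal_transformation_linear[OF assms]
  by (intro borel_measurable_continuous_onI linear_continuous_on)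
    (simp add: linear_conv_bounded_linear)

lemma DERIV_polyfun_0:
  fixes c :: "nat \<Rightarrow> real"
  assumes "n \<ge> 1"
  shows "((\<lambda>t. \<Sum>l\<le>n. c l * t ^ l) has_real_derivative c 1) (at 0)"
proof -
  have "((\<lambda>t. \<Sum>l\<le>n. c l * t ^ l) has_real_derivative (\<Sum>l\<le>n. c l * (real l * 0 ^ (l - 1)))) (at 0)"
    by (auto intro!: derivative_eq_intros sum.cong)
  also have "(\<Sum>l\<le>n. c l * (real l * 0 ^ (l - 1))) = (\<Sum>l\<le>n. if l = 1 then c l else 0)"
    by (intro sum.cong) (auto simp: power_0_left)
  also have "\<dots> = c 1"
    using assms by simp
  finally show ?thesis .
qed

lemma continuous_on_prod_list_inner:
  "continuous_on A (\<lambda>x. \<Prod>j\<leftarrow>js. x \<bullet> \<sigma> j)"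
  by (induction js) (auto intro!: continuous_intros)

lemma prod_list_inner_update:
  assumes "i \<notin> set js"
  shows "(\<Prod>j\<leftarrow>js. x \<bullet> (\<sigma>(i := v)) j) = (\<Prod>j\<leftarrow>js. x \<bullet> \<sigma> j)"
  using assms by (induction js) auto

locale isotropic_sphere_measure = prob_space M for M :: "'a::euclidean_space measure" +
  assumes sets_eq_borel [measurable_cong, simp]: "sets M = sets borel"
    and AE_norm_eq_1: "AE x in M. norm x = 1"
    and distr_orthogonal_transformation: "orthogonal_transformation T \<Longrightarrow> distr M borel T = M"
begin

lemma integrable_continuous_on:
  fixes h :: "'a \<Rightarrow> real"
  assumes "continuous_on UNIV h"
  shows "integrable M h"
proof -
  have "bounded (h ` sphere 0 1)"
    by (intro compact_imp_bounded compact_continuous_image continuous_on_subset[OF assms]) auto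
  then obtain B where B: "\<forall>x\<in>sphere 0 1. \<bar>h x\<bar> \<le> B"
    unfolding bounded_iff by auto
  show ?thesis
  proof (rule integrable_const_bound)
    show "AE x in M. norm (h x) \<le> B"
      using AE_norm_eq_1 by eventually_elim (simp add: B)
    show "h \<in> borel_measurable M"
      using borel_measurable_continuous_onI[OF assms] by simp
  qed
qed

lemma integral_power_inner_eq:
  assumes "norm v = norm w"
  shows "(\<integral>x. (x \<bullet> v) ^ k \<partial>M) = (\<integral>x. (x \<bullet> w) ^ k \<partial>M)"
proof -
  obtain T where T: "orthogonal_transformation T" "T v = w"
    using orthogonal_transformation_exists_real_inner[OF assms] .
  note [measurable] = orthogonal_transformation_borel_measurable[OF T(1)]
  have "(\<integral>x. (x \<bullet> w) ^ k \<partial>M) = (\<integral>x. (x \<bullet> w) ^ k \<partial>distr M borel T)"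
    by (simp add: distr_orthogonal_transformation[OF T(1)])
  also have "\<dots> = (\<integral>x. (T x \<bullet> T v) ^ k \<partial>M)"
    by (subst integral_distr) (auto simp: T(2))
  also have "\<dots> = (\<integral>x. (x \<bullet> v) ^ k \<partial>M)"
    using T(1) by (simp add: orthogonal_transformation_def)
  finally show ?thesis by simp
qed

lemma gram_cone_integral_power_inner:
  assumes "i \<in> I"
  shows "(\<lambda>\<sigma>. \<integral>x. (x \<bullet> \<sigma> i) ^ k \<partial>M) \<in> gram_cone I"
proof (cases "even k")
  case False
  have "(\<integral>x. (x \<bullet> v) ^ k \<partial>M) = 0" for v
    using integral_power_inner_eq[of "- v" v k] False by simp
  then show ?thesis by (simp add: gram_cone.const)
next
  case True
  then obtain l where l: "k = 2 * l" by (rule evenE)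
  obtain u :: 'a where u: "norm u = 1"
    using vector_choose_size[of 1] by auto
  define moment where "moment = (\<integral>x. (x \<bullet> u) ^ k \<partial>M)"
  have "moment \<ge> 0"
    using True by (simp add: moment_def zero_le_even_power)
  have "(\<integral>x. (x \<bullet> v) ^ k \<partial>M) = moment * (v \<bullet> v) ^ l" for v
  proof -
    have "(\<integral>x. (x \<bullet> v) ^ k \<partial>M) = (\<integral>x. (x \<bullet> (norm v *\<^sub>R u)) ^ k \<partial>M)"
      by (rule integral_power_inner_eq) (simp add: u)
    also have "\<dots> = moment * norm v ^ k"
      by (simp add: moment_def power_mult_distrib mult.commute)
    also have "norm v ^ k = (v \<bullet> v) ^ l"
      by (simp add: l power_mult power2_norm_eq_inner)
    finally show ?thesis .
  qed
  then show ?thesis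
    using \<open>moment \<ge> 0\<close> assms by (simp only: gram_cone_scale gram_cone_power gram_cone_inner)
qed

lemma DERIV_integral_power_inner:
  assumes "continuous_on UNIV h"
  shows "((\<lambda>t. \<integral>x. h x * (x \<bullet> (v + t *\<^sub>R w)) ^ Suc k \<partial>M) has_real_derivative
      Suc k * (\<integral>x. h x * (x \<bullet> w) * (x \<bullet> v) ^ k \<partial>M)) (at 0)"
proof -
  let ?h = "\<lambda>l x. h x * (x \<bullet> w) ^ l * (x \<bullet> v) ^ (Suc k - l)"
  let ?c = "\<lambda>l. (Suc k choose l) * integral\<^sup>L M (?h l)"
  have "(\<integral>x. h x * (x \<bullet> (v + t *\<^sub>R w)) ^ Suc k \<partial>M) = (\<Sum>l\<le>Suc k. ?c l * t ^ l)" for t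
  proof -
    have expand: "h x * (x \<bullet> (v + t *\<^sub>R w)) ^ Suc k
        = (\<Sum>l\<le>Suc k. (Suc k choose l) * t ^ l * ?h l x)" for x
      unfolding inner_add_right inner_scaleR_right add.commute[of "x \<bullet> v"] binomial_ring
      by (simp add: sum_distrib_left power_mult_distrib mult_ac del: sum.atMost_Suc)
    have "integrable M (?h l)" for l
      by (intro integrable_continuous_on continuous_intros assms)
    then show ?thesis
      by (simp only: expand Bochner_Integration.integral_sum integrable_mult_right
          integral_mult_right_zero) (simp only: mult_ac)
  qed
  moreover have "((\<lambda>t. \<Sum>l\<le>Suc k. ?c l * t ^ l) has_real_derivative ?c 1) (at 0)"
    by (rule DERIV_polyfun_0) simp
  ultimately show ?thesis by simp
qed

lemma gram_cone_integral_prod_list_inner_power: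
  assumes "i \<notin> I" "set js \<subseteq> I"
  shows "(\<lambda>\<sigma>. \<integral>x. (\<Prod>j\<leftarrow>js. x \<bullet> \<sigma> j) * (x \<bullet> \<sigma> i) ^ k \<partial>M) \<in> gram_cone (insert i I)"
  using assms(2)
proof (induction js arbitrary: k)
  case Nil
  then show ?case by (simp add: gram_cone_integral_power_inner)
next
  case (Cons j js)
  define G where "G \<sigma> = (\<integral>x. (\<Prod>j\<leftarrow>js. x \<bullet> \<sigma> j) * (x \<bullet> \<sigma> i) ^ Suc k \<partial>M)" for \<sigma>
  have "G \<in> gram_cone (insert i I)"
    unfolding G_def[abs_def] using Cons by (simp del: power_Suc)
  then obtain G' where G': "G' \<in> gram_cone (insert i I)"
    "\<And>\<sigma>. ((\<lambda>t. G (\<sigma>(i := \<sigma> i + t *\<^sub>R \<sigma> j))) has_real_derivative G' \<sigma>) (at 0)"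
    using gram_cone_directional_derivative[of G "insert i I" j i] Cons.prems by auto
  have "G' \<sigma> = Suc k * (\<integral>x. (\<Prod>j\<leftarrow>js. x \<bullet> \<sigma> j) * (x \<bullet> \<sigma> j) * (x \<bullet> \<sigma> i) ^ k \<partial>M)" for \<sigma>
  proof (rule DERIV_unique[OF G'(2)])
    have js: "i \<notin> set js"
      using assms(1) Cons.prems by auto
    have "G (\<sigma>(i := v)) = (\<integral>x. (\<Prod>j\<leftarrow>js. x \<bullet> \<sigma> j) * (x \<bullet> v) ^ Suc k \<partial>M)" for v
      unfolding G_def by (simp only: prod_list_inner_update[OF js] fun_upd_same)
    then show "((\<lambda>t. G (\<sigma>(i := \<sigma> i + t *\<^sub>R \<sigma> j))) has_real_derivative
        Suc k * (\<integral>x. (\<Prod>j\<leftarrow>js. x \<bullet> \<sigma> j) * (x \<bullet> \<sigma> j) * (x \<bullet> \<sigma> i) ^ k \<partial>M)) (at 0)"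
      by (simp only: DERIV_integral_power_inner continuous_on_prod_list_inner)
  qed
  then have "(\<lambda>\<sigma>. \<integral>x. (\<Prod>j\<leftarrow>j # js. x \<bullet> \<sigma> j) * (x \<bullet> \<sigma> i) ^ k \<partial>M) = (\<lambda>\<sigma>. (1 / Suc k) * G' \<sigma>)"
    by (simp add: mult_ac)
  also have "\<dots> \<in> gram_cone (insert i I)"
    using G'(1) by (intro gram_cone_scale) simp
  finally show ?case .
qed

lemma gram_cone_integral_prod_list_inner:
  assumes "i \<notin> I" "set js \<subseteq> I"
  shows "(\<lambda>\<sigma>. \<integral>x. (\<Prod>j\<leftarrow>js. x \<bullet> \<sigma> j) \<partial>M) \<in> gram_cone I"
proof -
  have "i \<notin> set js"
    using assms by auto
  then show ?thesis
    using gram_cone_update_zero[OF gram_cone_integral_prod_list_inner_power[OF assms, of 0]]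
    by (simp add: prod_list_inner_update del: fun_upd_apply)
qed

lemma continuous_on_gram_cone_update:
  assumes "f \<in> gram_cone I"
  shows "continuous_on A (\<lambda>x. f (\<sigma>(i := x)))"
proof (rule continuous_on_gram_cone[OF assms])
  show "continuous_on A (\<lambda>x. (\<sigma>(i := x)) j)" for j
    by (cases "j = i") auto
qed

lemma integral_inner_self_mult:
  assumes "continuous_on UNIV h"
  shows "(\<integral>x. (x \<bullet> x) * h x \<partial>M) = (\<integral>x. h x \<partial>M)"
proof (rule integral_cong_AE)
  show "(\<lambda>x. (x \<bullet> x) * h x) \<in> borel_measurable M" "h \<in> borel_measurable M"
    by (intro borel_measurable_integrable integrable_continuous_on continuous_intros assms)+
  show "AE x in M. (x \<bullet> x) * h x = h x"
    using AE_norm_eq_1 by eventually_elim (simp add: norm_eq_1)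
qed

lemma gram_cone_integral_update_inner_mult:
  fixes h :: "('i \<Rightarrow> 'a) \<Rightarrow> 'a \<Rightarrow> real"
  assumes "i \<notin> I" "a \<in> insert i I" "b \<in> insert i I"
    and "\<And>\<sigma>. continuous_on UNIV (h \<sigma>)"
    and integral: "(\<lambda>\<sigma>. integral\<^sup>L M (h \<sigma>)) \<in> gram_cone I"
    and integral_inner: "\<And>k. k \<in> I \<Longrightarrow> (\<lambda>\<sigma>. \<integral>x. (x \<bullet> \<sigma> k) * h \<sigma> x \<partial>M) \<in> gram_cone I"
  shows "(\<lambda>\<sigma>. \<integral>x. ((\<sigma>(i := x)) a \<bullet> (\<sigma>(i := x)) b) * h \<sigma> x \<partial>M) \<in> gram_cone I"
proof -
  consider (both) "a = i" "b = i" | (left) "a = i" "b \<in> I" "b \<noteq> i"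
    | (right) "b = i" "a \<in> I" "a \<noteq> i" | (neither) "a \<in> I" "b \<in> I" "a \<noteq> i" "b \<noteq> i"
    using assms(1-3) by auto
  then show ?thesis
  proof cases
    case both
    then show ?thesis using integral by (simp add: integral_inner_self_mult assms(4))
  next
    case left
    then show ?thesis using integral_inner[of b] by simp
  next
    case right
    then show ?thesis using integral_inner[of a] by (simp add: inner_commute[of "\<sigma> a" for \<sigma>])
  next
    case neither
    then show ?thesis using gram_cone.inner[OF _ _ integral, of a b] by (simp add: mult.assoc)
  qed
qed

text \<open>The product over \<open>js\<close> makes the induction go through: it collects the factors of \<open>f\<close> in
  which the integrated variable occurs.\<close>
lemma gram_cone_integral_update_prod_list_inner:
  assumes "i \<notin> I" "f \<in> gram_cone (insert i I)" "set js \<subseteq> I"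
  shows "(\<lambda>\<sigma>. \<integral>x. f (\<sigma>(i := x)) * (\<Prod>j\<leftarrow>js. x \<bullet> \<sigma> j) \<partial>M) \<in> gram_cone I"
  using assms(2,3)
proof (induction arbitrary: js)
  case (const c)
  then show ?case
    using assms(1) by (simp add: gram_cone_scale gram_cone_integral_prod_list_inner)
next
  case (add f g)
  have "integrable M (\<lambda>x. h (\<sigma>(i := x)) * (\<Prod>j\<leftarrow>js. x \<bullet> \<sigma> j))"
    if "h \<in> gram_cone (insert i I)" for h \<sigma>
    by (intro integrable_continuous_on continuous_on_mult continuous_on_gram_cone_update[OF that]
        continuous_on_prod_list_inner)
  with add show ?case
    by (simp add: distrib_right gram_cone.add del: fun_upd_apply)
next
  case (inner a b f)
  have "(\<lambda>\<sigma>. \<integral>x. ((\<sigma>(i := x)) a \<bullet> (\<sigma>(i := x)) b) * (f (\<sigma>(i := x)) * (\<Prod>j\<leftarrow>js. x \<bullet> \<sigma> j)) \<partial>M)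
      \<in> gram_cone I"
  proof (rule gram_cone_integral_update_inner_mult[OF assms(1) inner.hyps(1,2)])
    show "continuous_on UNIV (\<lambda>x. f (\<sigma>(i := x)) * (\<Prod>j\<leftarrow>js. x \<bullet> \<sigma> j))" for \<sigma>
      by (intro continuous_on_mult continuous_on_gram_cone_update[OF inner.hyps(3)]
          continuous_on_prod_list_inner)
    show "(\<lambda>\<sigma>. \<integral>x. (x \<bullet> \<sigma> k) * (f (\<sigma>(i := x)) * (\<Prod>j\<leftarrow>js. x \<bullet> \<sigma> j)) \<partial>M) \<in> gram_cone I"
      if "k \<in> I" for k
      using inner.IH[of "k # js"] inner.prems that by (simp add: mult_ac del: fun_upd_apply)
  qed (rule inner.IH[OF inner.prems])
  then show ?case by (simp only: mult.assoc)
qed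

lemma gram_cone_integral_update:
  assumes "i \<notin> I" "f \<in> gram_cone (insert i I)"
  shows "(\<lambda>\<sigma>. \<integral>x. f (\<sigma>(i := x)) \<partial>M) \<in> gram_cone I"
  using gram_cone_integral_update_prod_list_inner[OF assms, of "[]"] by simp

section \<open>Integrals over products of spheres\<close>

abbreviation power_measure :: "'i set \<Rightarrow> ('i \<Rightarrow> 'a) measure" where
  "power_measure I \<equiv> PiM I (\<lambda>_. M)"

lemma prob_space_power_measure: "prob_space (power_measure I)"
  by (intro prob_space_PiM prob_space_axioms)

lemma product_sigma_finite_const: "product_sigma_finite (\<lambda>_. M)"
  by (simp add: product_sigma_finite_def sigma_finite_measure_axioms)

lemma AE_power_measure_norm_eq_1:
  assumes "finite I"
  shows "AE \<sigma> in power_measure I. \<forall>i\<in>I. norm (\<sigma> i) = 1"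
  using assms by (intro AE_finite_allI AE_PiM_component prob_space_axioms AE_norm_eq_1)

lemma integrable_gram_cone:
  assumes "finite I" "f \<in> gram_cone I"
  shows "integrable (power_measure I) f"
proof -
  interpret I: prob_space "power_measure I" by (rule prob_space_power_measure)
  obtain u :: 'a where u: "norm u = 1"
    using vector_choose_size[of 1] by auto
  show ?thesis
  proof (rule I.integrable_const_bound)
    show "AE \<sigma> in power_measure I. norm (f \<sigma>) \<le> f (\<lambda>_. u)"
      using AE_power_measure_norm_eq_1[OF assms(1)]
      by eventually_elim (simp add: gram_cone_abs_le_diagonal[OF assms(2)] u)
    have "(\<lambda>\<sigma>. \<sigma> i) \<in> borel_measurable (power_measure I)" if "i \<in> I" for i
      using measurable_component_singleton[OF that, of "\<lambda>_. M"]
      by (simp cong: measurable_cong_sets)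
    then show "f \<in> borel_measurable (power_measure I)"
      using borel_measurable_gram_cone[OF assms(2), where \<sigma> = "\<lambda>\<sigma>. \<sigma>"] by simp
  qed
qed

lemma integral_gram_cone_insert:
  assumes "finite I" "i \<notin> I" "f \<in> gram_cone (insert i I)"
  shows "integral\<^sup>L (power_measure (insert i I)) f = (\<integral>\<sigma>. (\<integral>x. f (\<sigma>(i := x)) \<partial>M) \<partial>power_measure I)"
  using assms
  by (intro product_sigma_finite.product_integral_insert product_sigma_finite_const
      integrable_gram_cone) auto

lemma integral_gram_cone_nonneg:
  assumes "finite I" "f \<in> gram_cone I"
  shows "integral\<^sup>L (power_measure I) f \<ge> 0"
  using assms
proof (induction I arbitrary: f rule: finite_induct)
  case empty
  then show ?case
    by (simp add: PiM_empty lebesgue_integral_count_space_finite gram_cone_diagonal_nonneg)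
next
  case (insert i I)
  then show ?case
    by (simp add: integral_gram_cone_insert gram_cone_integral_update)
qed

lemma integral_gram_cone_le_diagonal:
  assumes "finite I" "f \<in> gram_cone I" "norm u = 1"
  shows "integral\<^sup>L (power_measure I) f \<le> f (\<lambda>_. u)"
proof -
  interpret I: prob_space "power_measure I" by (rule prob_space_power_measure)
  show ?thesis
  proof (rule I.integral_le_const[OF integrable_gram_cone[OF assms(1,2)]])
    show "AE \<sigma> in power_measure I. f \<sigma> \<le> f (\<lambda>_. u)"
      using AE_power_measure_norm_eq_1[OF assms(1)]
      by eventually_elim (use gram_cone_abs_le_diagonal[OF assms(2) _ assms(3)] abs_le_D1 in blast)
  qed
qed

lemma integral_gram_cone_singleton:
  assumes "f \<in> gram_cone {i}" "norm u = 1"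
  shows "integral\<^sup>L (power_measure {i}) f = f (\<lambda>_. u)"
proof -
  interpret I: prob_space "power_measure {i}" by (rule prob_space_power_measure)
  have "integral\<^sup>L (power_measure {i}) f = (\<integral>_. f (\<lambda>_. u) \<partial>power_measure {i})"
  proof (rule integral_cong_AE)
    show "f \<in> borel_measurable (power_measure {i})"
      using assms(1) by (intro borel_measurable_integrable integrable_gram_cone) auto
    show "AE \<sigma> in power_measure {i}. f \<sigma> = f (\<lambda>_. u)"
      using AE_power_measure_norm_eq_1[of "{i}", simplified]
      by eventually_elim (rule gram_cone_singleton_eq_diagonal[OF assms(1) _ assms(2)])
  qed simp
  then show ?thesis by (simp add: I.prob_space)
qed

lemma integral_gram_cone_le_merge:
  assumes "finite I" "i \<notin> I" "j \<in> I" "f \<in> gram_cone (insert i I)"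
  shows "integral\<^sup>L (power_measure (insert i I)) f \<le> (\<integral>\<sigma>. f (\<sigma>(i := \<sigma> j)) \<partial>power_measure I)"
  using assms
proof (induction I arbitrary: f rule: finite_psubset_induct)
  case (psubset I)
  note merged = gram_cone_merge[OF psubset.prems(3,2)]
  show ?case
  proof (cases "I = {j}")
    case True
    obtain u :: 'a where u: "norm u = 1"
      using vector_choose_size[of 1] by auto
    have "integral\<^sup>L (power_measure (insert i I)) f \<le> f (\<lambda>_. u)"
      using psubset u by (intro integral_gram_cone_le_diagonal) auto
    also have "f (\<lambda>_. u) = (\<integral>\<sigma>. f (\<sigma>(i := \<sigma> j)) \<partial>power_measure I)"
      using integral_gram_cone_singleton[OF merged[unfolded True] u]
      by (simp add: True fun_upd_idem del: fun_upd_apply)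
    finally show ?thesis .
  next
    case False
    then obtain k where k: "k \<in> I" "k \<noteq> j" "k \<noteq> i"
      using psubset.prems by blast
    define J where "J = I - {k}"
    have J: "finite J" "J \<subset> I" "k \<notin> J" "i \<notin> J" "j \<in> J" "k \<notin> insert i J"
      and I: "I = insert k J" "insert i I = insert k (insert i J)"
      using k psubset.hyps psubset.prems by (auto simp: J_def)
    let ?g = "\<lambda>\<sigma>. \<integral>x. f (\<sigma>(k := x)) \<partial>M"
    note f = psubset.prems(3)[unfolded I(2)]
    have "integral\<^sup>L (power_measure (insert i I)) f = integral\<^sup>L (power_measure (insert i J)) ?g"
      unfolding I(2) using J f by (intro integral_gram_cone_insert) auto
    also have "\<dots> \<le> (\<integral>\<sigma>. ?g (\<sigma>(i := \<sigma> j)) \<partial>power_measure J)"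
      by (intro psubset.IH gram_cone_integral_update[OF _ f] J)
    also have "\<dots> = (\<integral>\<sigma>. (\<integral>x. f ((\<sigma>(k := x))(i := (\<sigma>(k := x)) j)) \<partial>M) \<partial>power_measure J)"
      using k by (simp add: fun_upd_twist[where a=i and c=k] fun_upd_other del: fun_upd_apply)
    also have "\<dots> = (\<integral>\<sigma>. f (\<sigma>(i := \<sigma> j)) \<partial>power_measure I)"
      unfolding I(1) by (rule integral_gram_cone_insert[OF J(1,3) merged[unfolded I(1)], symmetric])
    finally show ?thesis .
  qed
qed

lemma integral_gram_cone_le_retract:
  assumes "finite I" "finite K" "I \<inter> K = {}" "f \<in> gram_cone (I \<union> K)"
    and "\<And>i. i \<in> I \<Longrightarrow> r i = i" "\<And>k. k \<in> K \<Longrightarrow> r k \<in> I"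
  shows "integral\<^sup>L (power_measure (I \<union> K)) f \<le> (\<integral>\<sigma>. f (\<lambda>i. \<sigma> (r i)) \<partial>power_measure I)"
  using assms(2-6)
proof (induction K arbitrary: f rule: finite_induct)
  case empty
  have "f \<sigma> = f (\<lambda>i. \<sigma> (r i))" for \<sigma>
    by (rule gram_cone_cong[OF empty(2)]) (simp add: empty)
  then show ?case by simp
next
  case (insert k K)
  let ?g = "\<lambda>\<sigma>. f (\<sigma>(k := \<sigma> (r k)))"
  have f: "f \<in> gram_cone (insert k (I \<union> K))"
    using insert.prems(2) by simp
  have "integral\<^sup>L (power_measure (I \<union> insert k K)) f \<le> integral\<^sup>L (power_measure (I \<union> K)) ?g"
    using assms(1) insert integral_gram_cone_le_merge[OF _ _ _ f] by simp
  also have "\<dots> \<le> (\<integral>\<sigma>. ?g (\<lambda>i. \<sigma> (r i)) \<partial>power_measure I)"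
  proof (rule insert.IH)
    show "?g \<in> gram_cone (I \<union> K)"
      using insert.prems(4) by (intro gram_cone_merge[OF f]) auto
  qed (use insert.prems in auto)
  also have "(\<lambda>\<sigma>. ?g (\<lambda>i. \<sigma> (r i))) = (\<lambda>\<sigma>. f (\<lambda>i. \<sigma> (r i)))"
    using insert.prems by (intro ext arg_cong[where f=f]) auto
  finally show ?case .
qed

section \<open>The correlation inequality\<close>

lemma integral_gram_cone_reindex:
  assumes "finite I" "inj_on r I" "f \<in> gram_cone I"
  shows "(\<integral>\<sigma>. f (\<lambda>i. \<sigma> (r i)) \<partial>power_measure (r ` I)) = integral\<^sup>L (power_measure I) f"
proof -
  let ?r = "\<lambda>\<sigma>. \<lambda>i\<in>I. \<sigma> (r i)"
  have "(\<integral>\<sigma>. f (\<lambda>i. \<sigma> (r i)) \<partial>power_measure (r ` I)) = (\<integral>\<sigma>. f (?r \<sigma>) \<partial>power_measure (r ` I))"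
    by (intro Bochner_Integration.integral_cong refl gram_cone_cong[OF assms(3)]) simp
  also have "\<dots> = integral\<^sup>L (distr (power_measure (r ` I)) (power_measure I) ?r) f"
  proof (rule integral_distr[symmetric])
    show "?r \<in> measurable (power_measure (r ` I)) (power_measure I)"
      by (intro measurable_restrict measurable_component_singleton) auto
    show "f \<in> borel_measurable (power_measure I)"
      using assms(1,3) by (intro borel_measurable_integrable integrable_gram_cone)
  qed
  also have "distr (power_measure (r ` I)) (power_measure I) ?r = power_measure I"
    using assms(2) by (intro distr_PiM_reindex prob_space_axioms) auto
  finally show ?thesis .
qed

lemma integral_gram_cone_mult_disjoint:
  assumes "finite I" "finite J" "I \<inter> J = {}" "f \<in> gram_cone I" "g \<in> gram_cone J"
  shows "(\<integral>\<sigma>. f \<sigma> * g \<sigma> \<partial>power_measure (I \<union> J))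
      = integral\<^sup>L (power_measure I) f * integral\<^sup>L (power_measure J) g"
proof -
  let ?m = "merge I J"
  have "(\<lambda>\<sigma>. f \<sigma> * g \<sigma>) \<in> gram_cone (I \<union> J)"
    by (intro gram_cone_mult gram_cone_mono[OF assms(4)] gram_cone_mono[OF assms(5)]) auto
  then have "(\<integral>\<sigma>. f \<sigma> * g \<sigma> \<partial>power_measure (I \<union> J))
      = (\<integral>\<sigma>. (\<integral>\<tau>. f (?m (\<sigma>, \<tau>)) * g (?m (\<sigma>, \<tau>)) \<partial>power_measure J) \<partial>power_measure I)"
    using assms(1-3)
    by (intro product_sigma_finite.product_integral_fold product_sigma_finite_const
        integrable_gram_cone) auto
  also have "\<dots> = (\<integral>\<sigma>. (\<integral>\<tau>. f \<sigma> * g \<tau> \<partial>power_measure J) \<partial>power_measure I)"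
  proof -
    have "f (?m (\<sigma>, \<tau>)) = f \<sigma>" "g (?m (\<sigma>, \<tau>)) = g \<tau>" for \<sigma> \<tau>
      using assms(3)
      by (auto intro!: gram_cone_cong[OF assms(4)] gram_cone_cong[OF assms(5)] simp: merge_def)
    then show ?thesis by simp
  qed
  finally show ?thesis by simp
qed

theorem integral_gram_cone_mult_ge:
  fixes f g :: "('i \<Rightarrow> 'a) \<Rightarrow> real"
  assumes "finite I" "f \<in> gram_cone I" "g \<in> gram_cone I"
  shows "integral\<^sup>L (power_measure I) f * integral\<^sup>L (power_measure I) g
      \<le> (\<integral>\<sigma>. f \<sigma> * g \<sigma> \<partial>power_measure I)"
proof -
  let ?f = "\<lambda>\<sigma>. f (\<lambda>i. \<sigma> (Inl i))" and ?g = "\<lambda>\<sigma>. g (\<lambda>i. \<sigma> (Inr i))"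
  let ?r = "case_sum Inl Inl :: 'i + 'i \<Rightarrow> 'i + 'i"
  let ?L = "Inl ` I :: ('i + 'i) set" and ?R = "Inr ` I :: ('i + 'i) set"
  have cone: "?f \<in> gram_cone ?L" "?g \<in> gram_cone ?R" "(\<lambda>\<sigma>. ?f \<sigma> * ?g \<sigma>) \<in> gram_cone (?L \<union> ?R)"
    by (intro gram_cone_mult gram_cone_reindex[OF assms(2)] gram_cone_reindex[OF assms(3)]; auto)+
  have "integral\<^sup>L (power_measure I) f * integral\<^sup>L (power_measure I) g
      = integral\<^sup>L (power_measure ?L) ?f * integral\<^sup>L (power_measure ?R) ?g"
    using assms by (simp add: integral_gram_cone_reindex)
  also have "\<dots> = (\<integral>\<sigma>. ?f \<sigma> * ?g \<sigma> \<partial>power_measure (?L \<union> ?R))"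
    using assms(1) by (intro integral_gram_cone_mult_disjoint[symmetric] cone) auto
  also have "\<dots> \<le> (\<integral>\<sigma>. ?f (\<lambda>z. \<sigma> (?r z)) * ?g (\<lambda>z. \<sigma> (?r z)) \<partial>power_measure ?L)"
    using assms(1) by (intro integral_gram_cone_le_retract cone) auto
  also have "\<dots> = (\<integral>\<sigma>. f \<sigma> * g \<sigma> \<partial>power_measure I)"
    using integral_gram_cone_reindex[OF assms(1) inj_Inl gram_cone_mult[OF assms(2,3)]] by simp
  finally show ?thesis .
qed

end

section \<open>The uniform measure on the sphere\<close>

lemma nn_integral_translation:
  fixes M :: "'a::euclidean_space measure"
  assumes "sets M = sets borel" "distr M borel ((+) c) = M" "h \<in> borel_measurable borel"
  shows "(\<integral>\<^sup>+x. h (c + x) \<partial>M) = (\<integral>\<^sup>+x. h x \<partial>M)"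
proof -
  have "(\<integral>\<^sup>+x. h x \<partial>M) = (\<integral>\<^sup>+x. h x \<partial>distr M borel ((+) c))"
    by (simp only: assms(2))
  also have "\<dots> = (\<integral>\<^sup>+x. h (c + x) \<partial>M)"
    using assms(1,3) by (subst nn_integral_distr) (auto cong: measurable_cong_sets)
  finally show ?thesis by simp
qed

text \<open>Uniqueness of Haar measure: integrate \<open>indicator A x * indicator B (y - x)\<close> in both orders.\<close>
lemma translation_invariant_emeasure_mult:
  fixes M :: "'a::euclidean_space measure"
  assumes "sigma_finite_measure M" and [measurable_cong, simp]: "sets M = sets borel"
    and invariant: "\<And>c. distr M borel ((+) c) = M"
    and [measurable]: "A \<in> sets borel" and B [measurable]: "B \<in> sets borel"
  shows "emeasure M A * emeasure lborel B = emeasure lborel A * emeasure M (uminus -` B)"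
proof -
  interpret M: sigma_finite_measure M by fact
  interpret pair_sigma_finite M lborel ..
  have shift_lborel: "(\<integral>\<^sup>+y. h (c + y) \<partial>lborel) = (\<integral>\<^sup>+y. h y \<partial>lborel)"
    if "h \<in> borel_measurable borel" for h :: "'a \<Rightarrow> ennreal" and c
    using that by (intro nn_integral_translation lborel_distr_plus) simp_all
  have [measurable]: "uminus -` B \<in> sets borel"
    using measurable_sets[of uminus borel borel, OF _ B] by simp
  let ?I = "\<lambda>x y. indicator A x * indicator B (y - x) :: ennreal"
  have "emeasure M A * emeasure lborel B = (\<integral>\<^sup>+x. indicator A x * emeasure lborel B \<partial>M)"
    by (simp add: nn_integral_multc)
  also have "\<dots> = (\<integral>\<^sup>+x. (\<integral>\<^sup>+y. ?I x y \<partial>lborel) \<partial>M)"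
  proof (rule nn_integral_cong)
    show "indicator A x * emeasure lborel B = (\<integral>\<^sup>+y. ?I x y \<partial>lborel)" for x
      using shift_lborel[of "\<lambda>y. indicator B (y - x)" x] by (simp add: nn_integral_cmult)
  qed
  also have "\<dots> = (\<integral>\<^sup>+y. (\<integral>\<^sup>+x. ?I x y \<partial>M) \<partial>lborel)"
    by (rule Fubini'[symmetric]) measurable
  also have "\<dots> = (\<integral>\<^sup>+y. (\<integral>\<^sup>+x. indicator A (x + y) * indicator (uminus -` B) x \<partial>M) \<partial>lborel)"
  proof (rule nn_integral_cong)
    show "(\<integral>\<^sup>+x. ?I x y \<partial>M) = (\<integral>\<^sup>+x. indicator A (x + y) * indicator (uminus -` B) x \<partial>M)" for y
      using nn_integral_translation[OF _ invariant, of "\<lambda>x. ?I x y" y]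
      by (simp add: add.commute indicator_def)
  qed
  also have "\<dots> = (\<integral>\<^sup>+x. (\<integral>\<^sup>+y. indicator A (x + y) * indicator (uminus -` B) x \<partial>lborel) \<partial>M)"
    by (rule Fubini') measurable
  also have "\<dots> = (\<integral>\<^sup>+x. emeasure lborel A * indicator (uminus -` B) x \<partial>M)"
    by (intro nn_integral_cong) (simp add: nn_integral_multc shift_lborel)
  also have "\<dots> = emeasure lborel A * emeasure M (uminus -` B)"
    by (simp add: nn_integral_cmult)
  finally show ?thesis .
qed

lemma emeasure_lborel_ball_neq_0:
  fixes a :: "'a::euclidean_space"
  assumes "r > 0"
  shows "emeasure lborel (ball a r) \<noteq> 0"
  using assms unit_ball_vol_pos[of "real DIM('a)"]
  by (auto simp: emeasure_ball ennreal_eq_0_iff not_le)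

lemma emeasure_lborel_ball_neq_infinity: "emeasure lborel (ball a r) \<noteq> \<infinity>"
  using emeasure_lborel_ball_finite[of a r] by simp

lemma orthogonal_transformation_vimage_ball:
  assumes "orthogonal_transformation T"
  shows "T -` ball 0 r = ball 0 r"
  by (auto simp: orthogonal_transformation_norm[OF assms])

lemma distr_lborel_orthogonal_transformation:
  fixes T :: "'a::euclidean_space \<Rightarrow> 'a"
  assumes T: "orthogonal_transformation T"
  shows "distr lborel borel T = lborel"
proof (rule measure_eqI)
  let ?M = "distr lborel borel T"
  note [measurable] = orthogonal_transformation_borel_measurable[OF T]
  have ball: "emeasure ?M (ball 0 r) = emeasure lborel (ball (0::'a) r)" for r
    by (simp add: emeasure_distr orthogonal_transformation_vimage_ball[OF T])
  have "sigma_finite_measure ?M"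
  proof
    show "\<exists>\<B>. countable \<B> \<and> \<B> \<subseteq> sets ?M \<and> \<Union>\<B> = space ?M \<and> (\<forall>B\<in>\<B>. emeasure ?M B \<noteq> \<infinity>)"
      by (rule exI[of _ "range (\<lambda>n::nat. ball 0 (real n))"])
        (auto simp: ball reals_Archimedean2 emeasure_lborel_ball_neq_infinity[simplified])
  qed
  moreover have "distr ?M borel ((+) c) = ?M" for c
  proof -
    obtain d where d: "c = T d"
      using orthogonal_transformation_surj[OF T] by (metis surjD)
    have "distr ?M borel ((+) c) = distr lborel borel ((+) c \<circ> T)"
      by (rule distr_distr) auto
    also have "(+) c \<circ> T = T \<circ> (+) d"
      by (auto simp: d linear_add[OF orthogonal_transformation_linear[OF T]])
    also have "distr lborel borel \<dots> = distr (distr lborel borel ((+) d)) borel T"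
      by (rule distr_distr[symmetric]) auto
    finally show ?thesis by (simp add: lborel_distr_plus)
  qed
  moreover have "uminus -` ball (0::'a) 1 = ball 0 1"
    by (rule orthogonal_transformation_vimage_ball) (simp add: orthogonal_transformation_neg)
  ultimately have "emeasure ?M A * emeasure lborel (ball (0::'a) 1)
      = emeasure lborel A * emeasure lborel (ball (0::'a) 1)" if "A \<in> sets borel" for A
    using translation_invariant_emeasure_mult[of ?M A "ball 0 1"] that by (simp add: ball)
  then show "emeasure ?M A = emeasure lborel A" if "A \<in> sets ?M" for A
    using that emeasure_lborel_ball_neq_0[OF zero_less_one, of "0 :: 'a"]
      emeasure_lborel_ball_neq_infinity[of "0 :: 'a" 1]
    by (metis infinity_ennreal_def mult_divide_eq_ennreal sets_distr)
qed simp

lemma distr_uniform_measure_ball_orthogonal_transformation: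
  fixes T :: "'a::euclidean_space \<Rightarrow> 'a"
  assumes T: "orthogonal_transformation T"
  shows "distr (uniform_measure lborel (ball 0 r)) borel T = uniform_measure lborel (ball 0 r)"
proof (rule measure_eqI)
  let ?U = "uniform_measure lborel (ball (0::'a) r)"
  note T_measurable [measurable] = orthogonal_transformation_borel_measurable[OF T]
  fix A assume "A \<in> sets (distr ?U borel T)"
  then have A [measurable]: "A \<in> sets borel" by simp
  have [measurable]: "T -` A \<in> sets borel"
    using measurable_sets[OF T_measurable A] by simp
  have "emeasure lborel (ball 0 r \<inter> T -` A) = emeasure (distr lborel borel T) (ball 0 r \<inter> A)"
    by (simp add: emeasure_distr vimage_Int orthogonal_transformation_vimage_ball[OF T])
  then show "emeasure (distr ?U borel T) A = emeasure ?U A"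
    by (simp add: emeasure_distr emeasure_uniform_measure
        distr_lborel_orthogonal_transformation[OF T])
qed simp

lemma sets_sphere_measure [measurable_cong, simp]: "sets sphere_measure = sets borel"
  by (simp add: sphere_measure_def)

lemma AE_sphere_measure_norm_eq_1: "AE x in (sphere_measure :: (real^'n) measure). norm x = 1"
proof -
  have "AE x in (lborel :: (real^'n) measure). x \<noteq> 0"
    by (rule AE_lborel_singleton)
  then have "AE x in uniform_measure lborel (ball (0::real^'n) 1). norm (sgn x) = 1"
    by (intro AE_uniform_measureI) (auto simp: norm_sgn)
  then show ?thesis
    unfolding sphere_measure_def by (subst AE_distr_iff) auto
qed

lemma distr_sphere_measure_orthogonal_transformation:
  fixes T :: "real^'n \<Rightarrow> real^'n"
  assumes T: "orthogonal_transformation T"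
  shows "distr sphere_measure borel T = sphere_measure"
proof -
  let ?U = "uniform_measure lborel (ball (0::real^'n) 1)"
  note [measurable] = orthogonal_transformation_borel_measurable[OF T]
  have "distr sphere_measure borel T = distr ?U borel (T \<circ> sgn)"
    unfolding sphere_measure_def by (rule distr_distr) auto
  also have "T \<circ> sgn = sgn \<circ> T"
    by (auto simp: sgn_div_norm orthogonal_transformation_scaleR[OF T]
        orthogonal_transformation_norm[OF T])
  also have "distr ?U borel \<dots> = distr (distr ?U borel T) borel sgn"
    by (rule distr_distr[symmetric]) auto
  also have "\<dots> = sphere_measure"
    by (simp add: distr_uniform_measure_ball_orthogonal_transformation[OF T] sphere_measure_def)
  finally show ?thesis .
qed

interpretation sphere: isotropic_sphere_measure "sphere_measure :: (real^'n) measure"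
proof (intro isotropic_sphere_measure.intro isotropic_sphere_measure_axioms.intro)
  show "prob_space (sphere_measure :: (real^'n) measure)"
    unfolding sphere_measure_def
    by (intro prob_space.prob_space_distr prob_space_uniform_measure emeasure_lborel_ball_neq_0
        emeasure_lborel_ball_neq_infinity) simp_all
qed (simp_all add: AE_sphere_measure_norm_eq_1 distr_sphere_measure_orthogonal_transformation)

lemma posmono_subset_gram_cone: "posmono N \<subseteq> gram_cone {..<N}"
proof
  fix f :: "(nat \<Rightarrow> real^'n) \<Rightarrow> real"
  assume "f \<in> posmono N"
  then obtain K :: "nat set" and c e where "\<forall>k\<in>K. c k > 0"
    and f: "f = (\<lambda>\<sigma>. \<Sum>k\<in>K. c k * monomial N (e k) \<sigma>)"
    unfolding posmono_def by blast
  then show "f \<in> gram_cone {..<N}"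
    unfolding f monomial_def
    by (intro gram_cone_sum gram_cone_scale gram_cone_prod gram_cone_power gram_cone_inner) auto
qed

theorem theorem1:
  fixes N :: nat and f g :: "(nat \<Rightarrow> real^'n) \<Rightarrow> real"
  assumes "CARD('n) \<ge> 2" and "N \<ge> 1"
    and "f \<in> posmono N" and "g \<in> posmono N"
  shows "Exp N f \<ge> 0 \<and> Exp N (\<lambda>\<sigma>. f \<sigma> * g \<sigma>) \<ge> Exp N f * Exp N g"
proof -
  have "f \<in> gram_cone {..<N}" "g \<in> gram_cone {..<N}"
    using assms(3,4) posmono_subset_gram_cone by blast+
  then show ?thesis
    unfolding Exp_def sphere_prod_def
    by (simp add: sphere.integral_gram_cone_nonneg sphere.integral_gram_cone_mult_ge)
qed

end
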